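(* Let $A_k=\{a_1,\dots,a_k\}$ with $1=a_1<a_2<\dots<a_k$ integers, and let $h_0$ be the smallest positive integer $h$ with $n(h)\ge a_k$. Then there exists an integer $h_2\ge h_0-1$ such that for every integer $h\ge h_2$: if $x$ is a gap at level $h$, then $x+a_k$ is a gap at level $h+1$.
   Context: For an integer $h\ge 0$, an integer $x\ge 0$ has an $h$-representation if $x=\sum_{i=1}^k c_ia_i$ with nonnegative integers $c_i$ and $\sum_i c_i\le h$. The $h$-range $n(h)$ is the largest integer $n$ such that every integer $0\le x\le n$ has an $h$-representation. An integer $x$ is a gap at level $h$ if $n(h)<x<ha_k$ and $x$ has no $h$-representation. *)

theory Defs
  imports Main
begin

definition has_rep :: "(nat \<Rightarrow> nat) \<Rightarrow> nat \<Rightarrow> nat \<Rightarrow> nat \<Rightarrow> bool" where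
  "has_rep a k h x \<longleftrightarrow>
     (\<exists>c :: nat \<Rightarrow> nat. x = (\<Sum>i=1..k. c i * a i) \<and> (\<Sum>i=1..k. c i) \<le> h)"

definition h_range :: "(nat \<Rightarrow> nat) \<Rightarrow> nat \<Rightarrow> nat \<Rightarrow> nat" where
  "h_range a k h = (GREATEST n. \<forall>x\<le>n. has_rep a k h x)"

definition is_gap :: "(nat \<Rightarrow> nat) \<Rightarrow> nat \<Rightarrow> nat \<Rightarrow> nat \<Rightarrow> bool" where
  "is_gap a k h x \<longleftrightarrow> h_range a k h < x \<and> x < h * a k \<and> \<not> has_rep a k h x"

definition h_zero :: "(nat \<Rightarrow> nat) \<Rightarrow> nat \<Rightarrow> nat" where
  "h_zero a k = (LEAST h. 0 < h \<and> a k \<le> h_range a k h)"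

text \<open>The operators \<^term>\<open>Greatest\<close> and \<^term>\<open>Least\<close> above are always attained for the
  bases considered, as the following facts show.\<close>

lemma has_rep_0: "has_rep a k h 0"
  unfolding has_rep_def by (rule exI[of _ "\<lambda>_. 0"]) simp

lemma has_rep_le:
  assumes "strict_mono_on {1..k} a" "has_rep a k h x"
  shows "x \<le> h * a k"
proof -
  obtain c where c: "x = (\<Sum>i=1..k. c i * a i)" "(\<Sum>i=1..k. c i) \<le> h"
    using assms(2) unfolding has_rep_def by blast
  have "a i \<le> a k" if "i \<in> {1..k}" for i
    using that assms(1) by (cases "i = k") (auto simp: strict_mono_on_def intro: less_imp_le)
  then have "x \<le> (\<Sum>i=1..k. c i * a k)"
    unfolding c(1) by (intro sum_mono mult_le_mono2)
  also have "\<dots> \<le> h * a k"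
    using c(2) by (simp add: sum_distrib_right[symmetric])
  finally show ?thesis .
qed

lemma h_range_ge_iff:
  assumes "strict_mono_on {1..k} a"
  shows "n \<le> h_range a k h \<longleftrightarrow> (\<forall>x\<le>n. has_rep a k h x)"
proof -
  let ?P = "\<lambda>n. \<forall>x\<le>n. has_rep a k h x"
  have bd: "m \<le> h * a k" if "?P m" for m
    using that has_rep_le[OF assms] by blast
  have P0: "?P 0" by (simp add: has_rep_0)
  have "?P (h_range a k h)"
    unfolding h_range_def by (rule GreatestI_nat[where P = ?P, OF P0]) (rule bd)
  moreover have "m \<le> h_range a k h" if "?P m" for m
    unfolding h_range_def by (rule Greatest_le_nat[where P = ?P, OF that]) (rule bd)
  ultimately show ?thesis by (meson le_trans)
qed

lemma h_zero_attained:
  assumes "k \<ge> 1" "a 1 = 1" "strict_mono_on {1..k} a"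
  shows "0 < h_zero a k \<and> a k \<le> h_range a k (h_zero a k)"
proof -
  have "has_rep a k (a k) x" if "x \<le> a k" for x
    unfolding has_rep_def
    using that assms(1,2)
    by (intro exI[of _ "\<lambda>i. if i = 1 then x else 0"])
       (simp add: if_distrib[of "\<lambda>y. y * _"] cong: if_cong)
  then have "a k \<le> h_range a k (a k)"
    using h_range_ge_iff[OF assms(3)] by blast
  moreover have "0 < a k"
  proof (cases "k = 1")
    case False
    then have "a 1 < a k"
      using assms(1) by (intro strict_mono_onD[OF assms(3)]) auto
    then show ?thesis by simp
  qed (use assms(2) in simp)
  ultimately show ?thesis
    unfolding h_zero_def by (intro LeastI[of "\<lambda>h. 0 < h \<and> a k \<le> h_range a k h" "a k"]) simp
qed

end

theory Submission
  imports Defs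
begin

text \<open>
  Write \<open>M = a\<^sub>k\<close> and suppose \<open>x + M\<close> is a sum of at most \<open>h + 1\<close> basis elements. If there are
  at least \<open>M\<close> summands, then two prefix sums agree modulo \<open>M\<close>, so some \<open>m \<ge> 1\<close> of the summands
  add up to \<open>q M\<close> with \<open>1 \<le> q \<le> m\<close>; replacing them by \<open>q - 1\<close> copies of \<open>M\<close> represents \<open>x\<close>
  with at most \<open>h\<close> summands. Otherwise \<open>x \<le> M\<^sup>2\<close>, and \<open>x\<close> is a sum of ones as soon as
  \<open>h \<ge> M\<^sup>2\<close>. Hence for \<open>h \<ge> M\<^sup>2\<close> a gap \<open>x\<close> at level \<open>h\<close> yields the gap \<open>x + M\<close> at level \<open>h + 1\<close>.
\<close>

lemma exists_list_of_coefficients: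
  fixes a c :: "'i \<Rightarrow> nat"
  assumes "finite I"
  shows "\<exists>xs. set xs \<subseteq> a ` I \<and> sum_list xs = (\<Sum>i\<in>I. c i * a i) \<and> length xs = (\<Sum>i\<in>I. c i)"
  using assms
proof (induction I rule: finite_induct)
  case empty
  then show ?case by simp
next
  case (insert j I)
  then obtain xs where "set xs \<subseteq> a ` I" "sum_list xs = (\<Sum>i\<in>I. c i * a i)"
      "length xs = (\<Sum>i\<in>I. c i)"
    by blast
  with insert.hyps show ?case
    by (intro exI[of _ "replicate (c j) (a j) @ xs"]) (auto simp: sum_list_replicate)
qed

lemma has_rep_Cons:
  assumes "has_rep a k h x" "i \<in> {1..k}"
  shows "has_rep a k (Suc h) (a i + x)"
proof -
  obtain c where c: "x = (\<Sum>j=1..k. c j * a j)" "(\<Sum>j=1..k. c j) \<le> h"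
    using assms(1) unfolding has_rep_def by blast
  \<comment> \<open>The weight \<open>f\<close> is left free: the instance \<open>a\<close> tracks
    the value, the constant 1 the number of summands.\<close>
  have "(\<Sum>j=1..k. (c(i := Suc (c i))) j * f j) = f i + (\<Sum>j=1..k. c j * f j)"
    for f :: "nat \<Rightarrow> nat"
    using assms(2) by (simp add: sum.remove[of _ i] del: One_nat_def)
  from this[of a] this[of "\<lambda>_. 1"] c show ?thesis
    unfolding has_rep_def by (intro exI[of _ "c(i := Suc (c i))"]) simp
qed

lemma has_rep_sum_list:
  assumes "set xs \<subseteq> a ` {1..k}"
  shows "has_rep a k (length xs) (sum_list xs)"
  using assms by (induction xs) (auto simp: has_rep_0 intro: has_rep_Cons)

lemma has_rep_mono:
  assumes "has_rep a k h x" "h \<le> h'"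
  shows "has_rep a k h' x"
  using assms unfolding has_rep_def by (blast intro: le_trans)

text \<open>A list puts the summands in an order, so that prefix sums and contiguous blocks make
  sense.\<close>

lemma has_rep_iff_list:
  "has_rep a k h x \<longleftrightarrow> (\<exists>xs. set xs \<subseteq> a ` {1..k} \<and> sum_list xs = x \<and> length xs \<le> h)"
proof
  assume "has_rep a k h x"
  then obtain c where c: "x = (\<Sum>i=1..k. c i * a i)" "(\<Sum>i=1..k. c i) \<le> h"
    unfolding has_rep_def by blast
  with exists_list_of_coefficients[of "{1..k}" a c]
  show "\<exists>xs. set xs \<subseteq> a ` {1..k} \<and> sum_list xs = x \<and> length xs \<le> h"
    by fastforce
next
  assume "\<exists>xs. set xs \<subseteq> a ` {1..k} \<and> sum_list xs = x \<and> length xs \<le> h"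
  then show "has_rep a k h x"
    using has_rep_sum_list has_rep_mono by blast
qed

lemma exists_sublist_sum_dvd:
  fixes xs :: "nat list"
  assumes "0 < M" "M \<le> length xs"
  obtains us vs ws where "xs = us @ vs @ ws" "vs \<noteq> []" "M dvd sum_list vs"
proof -
  let ?f = "\<lambda>j. sum_list (take j xs) mod M"
  \<comment> \<open>Counting the empty prefix, there are \<open>M + 1\<close> indices but at most
    \<open>M\<close> residues.\<close>
  have "card (?f ` {0..M}) \<le> card {..<M}"
    using assms(1) by (intro card_mono) auto
  then have "\<not> inj_on ?f {0..M}"
    by (intro pigeonhole) simp
  then obtain i j where ij: "i < j" "j \<le> M" "?f i = ?f j"
    unfolding inj_on_def by (metis atLeastAtMost_iff linorder_neqE_nat)
  define vs where "vs = take (j - i) (drop i xs)"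
  have tj: "take j xs = take i xs @ vs"
    using ij(1) by (metis vs_def le_add_diff_inverse less_imp_le take_add)
  have "sum_list (take i xs) + sum_list vs = sum_list (take j xs)"
    by (simp add: tj)
  with ij(3) have "M dvd sum_list vs"
    by (metis add_diff_cancel_left' le_add1 mod_eq_dvd_iff_nat)
  moreover have "vs \<noteq> []"
    using ij assms(2) by (simp add: vs_def)
  moreover have "xs = take i xs @ vs @ drop j xs"
    by (metis append_assoc append_take_drop_id tj)
  ultimately show thesis
    using that by blast
qed

lemma sum_list_le_length_mult:
  fixes xs :: "nat list"
  assumes "\<And>y. y \<in> set xs \<Longrightarrow> y \<le> M"
  shows "sum_list xs \<le> length xs * M"
  using assms by (induction xs) (simp_all add: add_mono)

lemma has_rep_cancel_max:
  assumes "k \<ge> 1" "a 1 = 1" "strict_mono_on {1..k} a"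
    and "a k * a k \<le> h" "has_rep a k (h + 1) (x + a k)"
  shows "has_rep a k h x"
proof -
  define M where "M = a k"
  have bounds: "1 \<le> a i \<and> a i \<le> M" if "i \<in> {1..k}" for i
    using strict_mono_on_leD[OF assms(3), of 1 i] strict_mono_on_leD[OF assms(3), of i k]
      that assms(1,2) by (simp add: M_def)
  have "M > 0"
    using bounds[of k] assms(1) by simp
  obtain xs where xs: "set xs \<subseteq> a ` {1..k}" "sum_list xs = x + M" "length xs \<le> h + 1"
    using assms(5) unfolding has_rep_iff_list M_def by blast
  show ?thesis
  proof (cases "M \<le> length xs")
    case True
    with \<open>M > 0\<close> obtain us vs ws
      where split: "xs = us @ vs @ ws" "vs \<noteq> []" "M dvd sum_list vs"
      by (rule exists_sublist_sum_dvd)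
    obtain q where q: "sum_list vs = M * q"
      using split(3) by blast
    have vs: "1 \<le> y \<and> y \<le> M" if "y \<in> set vs" for y
      using that xs(1) bounds by (auto simp: split(1))
    \<comment> \<open>Positive summands force \<open>q \<ge> 1\<close>, so the subtraction
      \<open>q - 1\<close> below is not truncated.\<close>
    have "0 < sum_list vs"
      using vs[of "hd vs"] split(2) by (cases vs) auto
    then have "q \<ge> 1"
      by (cases q) (simp_all add: q)
    have "M * q \<le> M * length vs"
      using sum_list_le_length_mult[of vs M] vs by (simp add: q mult.commute)
    with \<open>M > 0\<close> have "q \<le> length vs"
      by simp
    \<comment> \<open>The block \<open>vs\<close> is worth \<open>q\<close> copies of
      \<open>M\<close>. Keeping \<open>q - 1\<close> of them lowers the total from
      \<open>x + M\<close> to \<open>x\<close>, and \<open>q \<le> length vs\<close> makes the list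
      at least one entry shorter.\<close>
    let ?ys = "us @ ws @ replicate (q - 1) M"
    have "set ?ys \<subseteq> a ` {1..k}"
      using xs(1) assms(1) by (auto simp: split(1) M_def)
    moreover have "sum_list ?ys = x"
      using xs(2) \<open>q \<ge> 1\<close> by (cases q) (simp_all add: split(1) q sum_list_replicate algebra_simps)
    moreover have "length ?ys \<le> h"
      using xs(3) \<open>q \<ge> 1\<close> \<open>q \<le> length vs\<close> by (simp add: split(1))
    ultimately show ?thesis
      unfolding has_rep_iff_list by blast
  next
    case False
    \<comment> \<open>Here \<open>a k * a k \<le> h\<close> enters: few bounded summands keep
      \<open>x\<close> at most \<open>h\<close>, so \<open>x\<close> ones suffice.\<close>
    have "x \<le> sum_list xs"
      using xs(2) by simp
    also have "\<dots> \<le> length xs * M"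
      using xs(1) bounds by (intro sum_list_le_length_mult) auto
    also have "\<dots> \<le> M * M"
      using False by simp
    also have "\<dots> \<le> h"
      using assms(4) by (simp add: M_def)
    finally have "x \<le> h" .
    moreover have "1 \<in> a ` {1..k}"
      using assms(1,2) by (metis atLeastAtMost_iff image_eqI order_refl)
    ultimately show ?thesis
      unfolding has_rep_iff_list
      by (intro exI[of _ "replicate x 1"]) (auto simp: sum_list_replicate)
  qed
qed

text \<open>Every number up to \<open>h_range a k h\<close> is representable, so a nonrepresentable
  \<open>x\<close> lies above it.\<close>

lemma is_gap_iff:
  assumes "strict_mono_on {1..k} a"
  shows "is_gap a k h x \<longleftrightarrow> x < h * a k \<and> \<not> has_rep a k h x"
  unfolding is_gap_def using h_range_ge_iff[OF assms, of x h] by (auto simp: not_le)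

theorem theorem3:
  fixes a :: "nat \<Rightarrow> nat" and k :: nat
  assumes "k \<ge> 1"
    and "a 1 = 1"
    and "strict_mono_on {1..k} a"
  shows "\<exists>h2 \<ge> h_zero a k - 1. \<forall>h \<ge> h2. \<forall>x. is_gap a k h x \<longrightarrow> is_gap a k (h + 1) (x + a k)"
\<comment> \<open>The first entry of the maximum gives the required lower bound on
  \<open>h2\<close>, the second the threshold of \<open>has_rep_cancel_max\<close>.\<close>
proof (intro exI[of _ "max (h_zero a k - 1) (a k * a k)"] conjI allI impI)
  fix h x
  assume "max (h_zero a k - 1) (a k * a k) \<le> h" "is_gap a k h x"
  then show "is_gap a k (h + 1) (x + a k)"
    using has_rep_cancel_max[OF assms, of h x] by (auto simp: is_gap_iff[OF assms(3)])
qed simp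

end
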